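(* The polynomial $h_{0,2}$ equals $(b-a)(b+2a)+1$. Let $k$ be a positive integer. If $k$ is odd, then $$h_{k,2}=\frac{f_{k,2}\cdot f_{k-1,1}}{h_{0,2}\cdot f_{k-1,2}\cdot f_{k,1}},$$ and if $k$ is even, then $$h_{k,2}=\frac{f_{k,2}\cdot f_{k-1,1}}{f_{k-1,2}\cdot f_{k,1}}.$$
   Context: Let $f(z)=z^3-3a^2z+2a^3+b\in\mathbb{Z}[a,b][z]$, with iterates (in $z$) $f^0=\mathrm{Id}$, $f^m=f^{m-1}\circ f$. For integers $k\ge0$, $n\ge1$ put $f_{k,n}=f^{k+n}(a)-f^k(a)\in\mathbb{Z}[a,b]$ (monic as a polynomial in $b$ over $\mathbb{Z}[a]$). Define $h_{k,n}=f_{k,n}/\prod_i g_i^{\alpha_i}\in\mathbb{Z}[a,b]$, where $g_i$ runs over all distinct irreducible factors in $\mathbb{Z}[a,b]$ (taken monic in $b$ over $\mathbb{Z}[a]$) of the polynomials $f_{l,m}$ with $0\le l\le k$, $m\ge1$, $m\mid n$, $(l,m)\ne(k,n)$, and $\alpha_i\ge 0$ is the highest power of $g_i$ dividing $f_{k,n}$. *)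

theory Defs
  imports "HOL-Computational_Algebra.Computational_Algebra"
begin

text \<open>
  The ring \<open>\<int>[a,b]\<close> is modelled as \<open>\<int>[a][b]\<close>, i.e. \<^typ>\<open>int poly poly\<close> with outer variable \<open>b\<close>
  and coefficients in \<open>\<int>[a]\<close>.  Thus ``monic in \<open>b\<close> over \<open>\<int>[a]\<close>'' is \<open>lead_coeff p = 1\<close>.
\<close>

definition var_a :: "int poly poly" where
  "var_a = [:[:0, 1:]:]"

definition var_b :: "int poly poly" where
  "var_b = [:0, 1:]"

definition cubic :: "int poly poly poly" where
  "cubic = [: 2 * var_a ^ 3 + var_b, - 3 * var_a ^ 2, 0, 1 :]"

primrec iter :: "nat \<Rightarrow> int poly poly poly" where
  "iter 0 = [:0, 1:]"
| "iter (Suc m) = pcompose (iter m) cubic"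

definition f_poly :: "nat \<Rightarrow> nat \<Rightarrow> int poly poly" where
  "f_poly k n = poly (iter (k + n)) var_a - poly (iter k) var_a"

definition lower_factors :: "nat \<Rightarrow> nat \<Rightarrow> int poly poly set" where
  "lower_factors k n =
     {g. irreducible g \<and> lead_coeff g = 1 \<and>
         (\<exists>l m. l \<le> k \<and> 1 \<le> m \<and> m dvd n \<and> (l, m) \<noteq> (k, n) \<and> g dvd f_poly l m)}"

text \<open>
  The division is the exact one of \<open>\<int>[a,b]\<close>: the factors of the product are powers of
  pairwise non-associated primes, and each of these powers divides \<open>f_poly k n\<close>.
\<close>

definition h_poly :: "nat \<Rightarrow> nat \<Rightarrow> int poly poly" where
  "h_poly k n = f_poly k n div (\<Prod>g\<in>lower_factors k n. g ^ multiplicity g (f_poly k n))"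

end

(*
Write x_m = f^m(a), k = j + 1 and q(z,w) = z^2 + zw + w^2 - 3a^2, so that f(z) - f(w) = (z - w) q(z,w).
Then f_{k,1} = f_{j,1} Q with Q = q(x_{j+1}, x_j), and f_{k,2} = f_{j,2} Q H with
H = 1 + (x_{j+1} - x_j)(x_{j+2} + x_{j+1} + x_j).  Moreover h_{0,2} divides H when j is even.  It remains
to see that G, which is H / h_{0,2} for even j and H for odd j, has no irreducible factor g in common
with f_{k,1} f_{j,2}.
If g divides f_{j,1}, then H = 1 modulo g.  If g divides Q and H, then x_{j+1} is a fixed point of
multiplier -1 modulo g, so g divides 1 + 3(x_{j+1}^2 - a^2), which is impossible modulo 3 because g is
monic in b.  If g divides f_{j,2} and QH = q(x_{j+2}, x_j), then g divides 3(x_j^2 - a^2).  Here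
x_j = -a modulo g would put both critical orbits on a 2-cycle along a whole curve, which an escape
estimate at a = 10 excludes.  Finally x_j = a modulo g forces g to divide h_{0,2} and j to be even, and
then G = -3a(b - a) or -6a(b - a) modulo h_{0,2}.
*)
theory Submission
  imports Defs
begin

section \<open>The cubic, its critical orbit and difference quotients\<close>

definition cub :: "'a::comm_ring_1 \<Rightarrow> 'a \<Rightarrow> 'a \<Rightarrow> 'a" where
  "cub a b z = z ^ 3 - 3 * a ^ 2 * z + 2 * a ^ 3 + b"

text \<open>The parameters are elements of any commutative ring, so that one definition serves both
  Z[a][b] and the complex numbers after specializing a. The starting point a is a critical point of
  the cubic; the other one is -a.\<close>

primrec orb :: "'a::comm_ring_1 \<Rightarrow> 'a \<Rightarrow> nat \<Rightarrow> 'a" where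
  "orb a b 0 = a"
| "orb a b (Suc m) = cub a b (orb a b m)"

definition quot :: "'a::comm_ring_1 \<Rightarrow> 'a \<Rightarrow> 'a \<Rightarrow> 'a" where
  "quot a z w = z ^ 2 + z * w + w ^ 2 - 3 * a ^ 2"

definition per2 :: "'a::comm_ring_1 \<Rightarrow> 'a \<Rightarrow> 'a" where
  "per2 a b = (b - a) * (b + 2 * a) + 1"

definition ratio :: "'a::comm_ring_1 \<Rightarrow> 'a \<Rightarrow> nat \<Rightarrow> 'a" where
  "ratio a b j = 1 + (orb a b (Suc j) - orb a b j) *
     (orb a b (Suc (Suc j)) + orb a b (Suc j) + orb a b j)"

lemma cub_diff: "cub a b z - cub a b w = (z - w) * quot a z w"
  by (simp add: cub_def quot_def algebra_simps power2_eq_square power3_eq_cube)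

lemma dvd_cub_diff: "m dvd z - w \<Longrightarrow> m dvd cub a b z - cub a b w"
  by (simp add: cub_diff)

lemma orb_diff_Suc:
  "orb a b (Suc k + n) - orb a b (Suc k) =
     (orb a b (k + n) - orb a b k) * quot a (orb a b (k + n)) (orb a b k)"
  by (simp add: cub_diff)

lemma orb_diff_dvd_mono:
  assumes "l \<le> k"
  shows "orb a b (l + n) - orb a b l dvd orb a b (k + n) - orb a b k"
  using assms
proof (induction k rule: dec_induct)
  case (step k)
  then show ?case using orb_diff_Suc[of a b k n] by (metis dvd_mult2)
qed simp

text \<open>One step of the orbit multiplies y - x by \<open>quot a y x\<close>, so z - y is a
  multiple of that quotient. Replacing y by z in \<open>quot a y x\<close> adds (z - y)(z + y + x),
  and the common factor comes out.\<close>

lemma quot_period2: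
  "quot a (orb a b (Suc (Suc j))) (orb a b j) = quot a (orb a b (Suc j)) (orb a b j) * ratio a b j"
proof -
  let ?x = "orb a b j" and ?y = "orb a b (Suc j)" and ?z = "orb a b (Suc (Suc j))"
  have "?z - ?y = (?y - ?x) * quot a ?y ?x"
    using cub_diff[of a b ?y ?x] by simp
  moreover have "quot a ?z ?x = quot a ?y ?x + (?z - ?y) * (?z + ?y + ?x)"
    by (simp add: quot_def algebra_simps power2_eq_square)
  ultimately have "quot a ?z ?x = quot a ?y ?x + (?y - ?x) * quot a ?y ?x * (?z + ?y + ?x)"
    by simp
  then show ?thesis
    by (simp add: ratio_def algebra_simps del: orb.simps)
qed

section \<open>The orbit modulo \<open>per2\<close> and its square\<close>

lemma orb_two: "orb a b 2 - a = (b - a) * per2 a b"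
  by (simp add: numeral_2_eq_2 cub_def per2_def algebra_simps power2_eq_square power3_eq_cube)

text \<open>Modulo \<open>per2 a b\<close> the critical orbit is the cycle a -> b -> a, because f(a)
  = b and \<open>orb_two\<close> gives f(b) = a there.\<close>

lemma orb_parity:
  "per2 a b dvd orb a b (2 * i) - a \<and> per2 a b dvd orb a b (Suc (2 * i)) - b"
proof (induction i)
  case 0
  show ?case by (simp add: cub_def algebra_simps power2_eq_square power3_eq_cube)
next
  case (Suc i)
  have c: "cub a b a = b"
    by (simp add: cub_def algebra_simps power2_eq_square power3_eq_cube)
  have "per2 a b dvd orb a b (2 * Suc i) - cub a b b"
    using dvd_cub_diff[of "per2 a b" "orb a b (Suc (2 * i))" b a b] Suc by simp
  moreover have "per2 a b dvd cub a b b - a"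
    using orb_two[of a b] by (simp add: numeral_2_eq_2 c)
  ultimately have 1: "per2 a b dvd orb a b (2 * Suc i) - a"
    by (metis diff_add_cancel add_diff_eq dvd_add)
  have "per2 a b dvd orb a b (Suc (2 * Suc i)) - b"
    using dvd_cub_diff[OF 1, of a b] by (simp add: c)
  with 1 show ?case by blast
qed

text \<open>Because \<open>a\<close> is a critical point of the cubic, the congruences modulo \<open>per2 a b\<close> lift to
  explicit ones modulo its square.\<close>

lemma orb_parity_square:
  "per2 a b ^ 2 dvd orb a b (2 * Suc i) - (a + (b - a) * per2 a b) \<and>
   per2 a b ^ 2 dvd orb a b (Suc (2 * Suc i)) - b"
proof (induction i)
  have *: "per2 a b ^ 2 dvd orb a b (Suc (2 * Suc i)) - b"
    if "per2 a b ^ 2 dvd orb a b (2 * Suc i) - (a + (b - a) * per2 a b)" for i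
  proof -
    have "per2 a b ^ 2 dvd cub a b (orb a b (2 * Suc i)) - cub a b (a + (b - a) * per2 a b)"
      using that by (rule dvd_cub_diff)
    \<comment> \<open>Expansion at the critical point: f(a + t) = b + 3 a t^2 + t^3 has no linear
      term. Here t = (b - a) h.\<close>
    moreover have "cub a b (a + (b - a) * h) = b + h ^ 2 * ((b - a) ^ 2 * (3 * a + (b - a) * h))" for h
      by (simp add: cub_def algebra_simps power2_eq_square power3_eq_cube)
    ultimately have "per2 a b ^ 2 dvd orb a b (Suc (2 * Suc i)) -
        (b + per2 a b ^ 2 * ((b - a) ^ 2 * (3 * a + (b - a) * per2 a b)))"
      by simp
    then have "per2 a b ^ 2 dvd (orb a b (Suc (2 * Suc i)) - b) -
        per2 a b ^ 2 * ((b - a) ^ 2 * (3 * a + (b - a) * per2 a b))"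
      by (simp only: diff_diff_eq)
    then show ?thesis
      by (metis dvd_add dvd_triv_left diff_add_cancel)
  qed
  {
    case 0
    have "orb a b 2 = a + (b - a) * per2 a b"
      using orb_two[of a b] by (simp only: diff_eq_eq add.commute)
    then show ?case using *[of 0]
      by (simp only: mult_Suc_right mult_0_right add_0_right diff_self dvd_0_right)
  next
    case (Suc i)
    have "per2 a b ^ 2 dvd orb a b (2 * Suc (Suc i)) - cub a b b"
      using dvd_cub_diff[of "per2 a b ^ 2" "orb a b (Suc (2 * Suc i))" b a b] Suc by simp
    moreover have "cub a b b = a + (b - a) * per2 a b"
      by (simp add: cub_def per2_def algebra_simps power2_eq_square power3_eq_cube)
    ultimately show ?case using *[of "Suc i"] by (simp del: orb.simps)
  }
qed

text \<open>Dividing by \<open>per2\<close> costs one order, so residues modulo its square are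
  needed to find G modulo \<open>per2\<close>. Index 0 gives the coefficient 3 and later even
  indices give 6: x_0 is exactly a, while every later even iterate carries the first-order term (b -
  a) \<open>per2\<close>.\<close>

lemma ratio_even:
  obtains G where "ratio a b (2 * i) = per2 a b * G"
    and "per2 a b dvd G + 3 * (b - a) * a \<or> per2 a b dvd G + 6 * (b - a) * a"
proof (cases i)
  case 0
  have "ratio a b 0 = per2 a b * ((b - a) ^ 2 + 1)"
    by (simp add: ratio_def cub_def per2_def algebra_simps power2_eq_square power3_eq_cube)
  moreover have "(b - a) ^ 2 + 1 + 3 * (b - a) * a = per2 a b"
    by (simp add: per2_def algebra_simps power2_eq_square)
  ultimately show ?thesis using that 0 by (metis dvd_refl mult_0_right)
next
  case (Suc l)
  let ?h = "per2 a b"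
  obtain u where u: "orb a b (2 * i) = a + (b - a) * ?h + ?h ^ 2 * u"
    using orb_parity_square[of a b l] Suc by (metis dvdE add.commute diff_add_cancel)
  obtain v where v: "orb a b (Suc (2 * i)) = b + ?h ^ 2 * v"
    using orb_parity_square[of a b l] Suc by (metis dvdE add.commute diff_add_cancel)
  obtain w where w: "orb a b (Suc (Suc (2 * i))) = a + (b - a) * ?h + ?h ^ 2 * w"
    using orb_parity_square[of a b "Suc l"] Suc
    by (metis dvdE add.commute diff_add_cancel mult_Suc_right add_2_eq_Suc)
  \<comment> \<open>All terms of \<open>ratio\<close> of order two and higher in
    \<open>per2\<close>, divided by its square.\<close>
  define t where "t = - 2 * (b - a) ^ 2 + (b - a) * (1 - ?h) * (u + v + w) +
      (v - u) * (b + 2 * a + 2 * (b - a) * ?h + ?h ^ 2 * (u + v + w))"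
  define G where "G = 1 + (b - a) * (b - 4 * a) + ?h * t"
  \<comment> \<open>Stated for a free h, so that \<open>per2\<close> can be treated as an
    indeterminate.\<close>
  have expand: "1 + (b + h ^ 2 * v - (a + (b - a) * h + h ^ 2 * u)) *
       ((a + (b - a) * h + h ^ 2 * w) + (b + h ^ 2 * v) + (a + (b - a) * h + h ^ 2 * u)) =
     (1 + (b - a) * (b + 2 * a)) + h * ((b - a) * (b - 4 * a) + h * (- 2 * (b - a) ^ 2 +
      (b - a) * (1 - h) * (u + v + w) + (v - u) * (b + 2 * a + 2 * (b - a) * h + h ^ 2 * (u + v + w))))" for h
    by (simp add: algebra_simps power2_eq_square)
  have "ratio a b (2 * i) = ?h * G"
    unfolding ratio_def u v w expand G_def t_def
    by (simp add: algebra_simps per2_def[symmetric]) (simp add: per2_def algebra_simps)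
  moreover have "G + 6 * (b - a) * a = ?h * (1 + t)"
    by (simp add: G_def per2_def algebra_simps)
  ultimately show ?thesis using that by (metis dvd_triv_left)
qed

section \<open>Escape estimates at a = 10\<close>

text \<open>The first image of 10 is b. Outside radius 2000 the term z^3 outweighs 300 z - 2000 - b,
  so the orbit never falls below the modulus of b; in particular it misses -10.\<close>

lemma escape_large:
  fixes b :: complex
  assumes "norm b \<ge> 2000"
  shows "norm (orb 10 b (Suc n)) \<ge> 2000"
proof -
  have "norm (orb 10 b (Suc n)) \<ge> norm b"
  proof (induction n)
    case 0
    show ?case by (simp add: cub_def)
  next
    case (Suc n)
    define z where "z = orb 10 b (Suc n)"
    have z: "norm z \<ge> norm b" using Suc by (simp add: z_def)
    have "norm (z ^ 3) \<le> norm (cub 10 b z) + norm (300 * z - 2000 - b)"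
      by (rule order.trans[OF _ norm_triangle_ineq]) (simp add: cub_def)
    also have "norm (300 * z - 2000 - b) \<le> 300 * norm z + 2000 + norm b"
      by (rule order.trans[OF norm_triangle_ineq4] add_mono order.refl)+ (simp_all add: norm_mult)
    finally have *: "norm z ^ 3 \<le> norm (cub 10 b z) + (300 * norm z + 2000 + norm b)"
      by (simp add: norm_power)
    have "2000 * 2000 * norm z \<le> norm z * norm z * norm z"
      using z assms by (intro mult_mono) auto
    with * z assms have "norm (cub 10 b z) \<ge> norm b"
      by (simp add: power3_eq_cube)
    then show ?case by (simp add: z_def)
  qed
  with assms show ?thesis by simp
qed

text \<open>The critical value f(-10) = b + 4000 already lies outside radius 2000, and one more step
  cannot bring such a point back to -10.\<close>

lemma escape_small:
  fixes b :: complex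
  assumes "norm b < 2000"
  shows "cub 10 b (cub 10 b (- 10)) \<noteq> - 10"
proof
  assume eq: "cub 10 b (cub 10 b (- 10)) = - 10"
  define z where "z = cub 10 b (- 10)"
  have "norm (4000 :: complex) \<le> norm z + norm b"
    by (rule order.trans[OF _ norm_triangle_ineq4]) (simp add: z_def cub_def)
  with assms have z: "norm z > 2000" by simp
  have "z ^ 3 = 300 * z - 2000 - b - 10"
    using eq by (simp add: z_def[symmetric]) (simp add: cub_def algebra_simps)
  then have "norm z ^ 3 = norm (300 * z - 2000 - b - 10)"
    by (simp add: norm_power[symmetric])
  also have "\<dots> \<le> 300 * norm z + 2000 + norm b + 10"
    by (rule order.trans[OF norm_triangle_ineq4] add_mono order.refl)+ (simp_all add: norm_mult)
  finally have "norm z ^ 3 \<le> 300 * norm z + 2000 + norm b + 10" .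
  moreover have "2000 * 2000 * norm z \<le> norm z * norm z * norm z"
    using z by (intro mult_mono) auto
  ultimately show False using z assms by (simp add: power3_eq_cube)
qed

lemma no_critical_2_cycle:
  fixes b :: complex
  assumes "orb 10 b j = - 10" "orb 10 b (Suc (Suc j)) = - 10"
  shows False
proof (cases "norm b < 2000")
  case True
  then show ?thesis using escape_small[of b] assms by simp
next
  case False
  show ?thesis
  proof (cases j)
    \<comment> \<open>The escape estimate covers only the images of 10, so the starting point is
      compared with -10 directly.\<close>
    case 0
    with assms show ?thesis by simp
  next
    case (Suc n)
    with False escape_large[of b n] assms show ?thesis by (simp del: orb.simps)
  qed
qed

section \<open>Specialization of a to 10 and b to a complex number\<close>

text \<open>Any integer large enough for the escape estimates above could replace \<open>10\<close>.\<close>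

definition specialize :: "complex \<Rightarrow> int poly poly \<Rightarrow> complex" where
  "specialize t p = poly (map_poly (\<lambda>q. of_int (poly q 10)) p) t"

lemma specialize_add: "specialize t (p + q) = specialize t p + specialize t q"
proof -
  have "map_poly (\<lambda>q. of_int (poly q 10) :: complex) (p + q) =
     map_poly (\<lambda>q. of_int (poly q 10)) p + map_poly (\<lambda>q. of_int (poly q 10)) q"
    by (rule poly_eqI) (simp add: coeff_map_poly)
  then show ?thesis by (simp add: specialize_def)
qed

lemma specialize_mult: "specialize t (p * q) = specialize t p * specialize t q"
proof -
  have "map_poly (\<lambda>q. of_int (poly q 10) :: complex) (p * q) =
     map_poly (\<lambda>q. of_int (poly q 10)) p * map_poly (\<lambda>q. of_int (poly q 10)) q"
    by (rule poly_eqI) (simp add: coeff_map_poly coeff_mult poly_sum)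
  then show ?thesis by (simp add: specialize_def)
qed

lemma specialize_one: "specialize t 1 = 1"
  by (simp add: specialize_def map_poly_1)

lemma specialize_zero: "specialize t 0 = 0"
  by (simp add: specialize_def)

lemma specialize_minus: "specialize t (- p) = - specialize t p"
  using specialize_add[of t p "- p"] by (simp add: specialize_zero add_eq_0_iff)

lemma specialize_diff: "specialize t (p - q) = specialize t p - specialize t q"
  using specialize_add[of t p "- q"] by (simp add: specialize_minus)

lemma specialize_of_nat: "specialize t (of_nat n) = of_nat n"
  by (induction n) (simp_all add: specialize_zero specialize_add specialize_one)

lemma specialize_numeral: "specialize t (numeral n) = numeral n"
  using specialize_of_nat[of t "numeral n"] by simp

lemma specialize_power: "specialize t (p ^ n) = specialize t p ^ n"
  by (induction n) (simp_all add: specialize_one specialize_mult)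

lemma specialize_var: "specialize t var_a = 10" "specialize t var_b = t"
  by (simp_all add: specialize_def var_a_def var_b_def map_poly_pCons)

lemma specialize_orb: "specialize t (orb var_a var_b n) = orb 10 t n"
  by (induction n)
    (simp_all add: cub_def specialize_var specialize_add specialize_diff specialize_mult
      specialize_power specialize_numeral)

text \<open>A leading coefficient 1 survives the substitution, so the degree is kept and the
  fundamental theorem of algebra applies.\<close>

lemma specialize_root:
  assumes "lead_coeff g = 1" "degree g > 0"
  obtains t where "specialize t g = 0"
proof -
  have "degree (map_poly (\<lambda>q. of_int (poly q 10) :: complex) g) = degree g"
    using assms(1) by (intro map_poly_degree_eq) simp
  with assms(2) have "\<exists>t. specialize t g = 0"
    unfolding specialize_def by (intro alg_closed_imp_poly_has_root) simp
  then show ?thesis using that by blast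
qed

section \<open>Divisibility and monic polynomials\<close>

text \<open>A monic polynomial of positive degree is not a unit over a nontrivial quotient ring. The
  quotient by r may have zero divisors, but multiplication by a monic g still preserves leading
  terms; hence the inverse v can be stripped of its leading terms one by one.\<close>

lemma monic_unit_mod_const:
  fixes g v :: "'a::idom poly"
  assumes "lead_coeff g = 1" "degree g > 0" "[:r:] dvd g * v - 1"
  shows "r dvd 1"
  using assms(3)
proof (induction "degree v" arbitrary: v rule: less_induct)
  case less
  have co: "r dvd coeff (g * v - 1) n" for n
    using less.prems by (simp add: const_poly_dvd_iff)
  show ?case
  proof (cases "degree v = 0")
    case True
    then obtain c where v: "v = [:c:]" using degree_eq_zeroE by blast
    \<comment> \<open>At \<open>degree g\<close> the product has coefficient c, and the subtracted 1
      contributes nothing there because \<open>degree g > 0\<close>.\<close>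
    have "r dvd c" using co[of "degree g"] assms(1,2) by (simp add: v coeff_1)
    then have "[:r:] dvd g * v" by (simp add: v const_poly_dvd_iff)
    with less.prems have "[:r:] dvd 1" by (metis dvd_diff_right_iff)
    then show ?thesis by (simp add: one_pCons)
  next
    case False
    let ?m = "monom (lead_coeff v) (degree v)"
    have "r dvd lead_coeff v"
      using co[of "degree g + degree v"] assms(1,2) by (simp add: coeff_mult_degree_sum coeff_1)
    then have "[:r:] dvd g * ?m" by (intro dvd_mult) (simp add: const_poly_dvd_iff)
    then have "[:r:] dvd (g * v - 1) - g * ?m" using less.prems by (rule dvd_diff[rotated])
    then have "[:r:] dvd g * (v - ?m) - 1" by (simp add: algebra_simps)
    moreover have "degree (v - ?m) < degree v"
      using False by (intro degree_lessI)
        (auto simp: coeff_eq_0 coeff_monom)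
    ultimately show ?thesis using less.hyps by blast
  qed
qed

lemma irreducible_monic_degree_pos:
  fixes g :: "'a::idom poly"
  assumes "irreducible g" "lead_coeff g = 1"
  shows "degree g > 0"
  using assms by (metis degree_eq_zeroE gr0I irreducible_not_unit one_pCons coeff_pCons_0 dvd_refl)

lemma nonconst_not_dvd_const:
  fixes g :: "'a::idom poly"
  assumes "degree g > 0" "c \<noteq> 0"
  shows "\<not> g dvd [:c:]"
  using assms dvd_imp_degree_le[of g "[:c:]"] by auto

section \<open>Leading coefficients in b\<close>

lemma poly_iter: "poly (iter m) z = (cub var_a var_b ^^ m) z"
proof (induction m arbitrary: z)
  case (Suc m)
  have "poly cubic z = cub var_a var_b z"
    by (simp add: cubic_def cub_def algebra_simps power2_eq_square power3_eq_cube)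
  with Suc show ?case by (simp add: poly_pcompose funpow_swap1)
qed simp

text \<open>\<open>iter\<close> adds the cubic on the inside and \<open>orb\<close> on the outside;
  both agree with powers of the map \<open>cub var_a var_b\<close>.\<close>

lemma f_poly_eq: "f_poly k n = orb var_a var_b (k + n) - orb var_a var_b k"
proof -
  have "orb var_a var_b m = (cub var_a var_b ^^ m) var_a" for m
    by (induction m) simp_all
  then show ?thesis by (simp add: f_poly_def poly_iter)
qed

lemma degree_cub:
  assumes "degree z \<ge> 1" "lead_coeff z = 1"
  shows "degree (cub var_a var_b z) = 3 * degree z \<and> lead_coeff (cub var_a var_b z) = 1"
proof -
  define r where "r = - (3 * var_a ^ 2 * z) + (2 * var_a ^ 3 + var_b)"
  have cub: "cub var_a var_b z = z ^ 3 + r"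
    by (simp add: cub_def r_def)
  have "3 * var_a ^ 2 = [:3 * [:0, 1:] ^ 2:]" "2 * var_a ^ 3 + var_b = [:2 * [:0, 1:] ^ 3, 1:]"
    by (simp_all add: var_a_def var_b_def numeral_poly power2_eq_square power3_eq_cube)
  then have "degree (3 * var_a ^ 2 * z) \<le> degree z" "degree (2 * var_a ^ 3 + var_b) \<le> degree z"
    using assms(1) by (simp_all only:) simp_all
  then have "degree r \<le> degree z"
    unfolding r_def by (intro degree_add_le[of "- _"]) (simp_all only: degree_minus)
  moreover have d: "degree (z ^ 3) = 3 * degree z"
    using assms by (subst degree_power_eq) auto
  ultimately have lt: "degree r < degree (z ^ 3)" using assms(1) by simp
  have "lead_coeff (z ^ 3) = 1" by (simp only: lead_coeff_power assms(2) power_one)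
  then show ?thesis
    unfolding cub using d lead_coeff_add_le[OF lt] degree_add_eq_left[OF lt]
    by (simp only: add.commute)
qed

text \<open>The count starts at index 1, since x_0 = a is constant in b and x_1 = b.\<close>

lemma degree_orb:
  "degree (orb var_a var_b (Suc n)) = 3 ^ n \<and> lead_coeff (orb var_a var_b (Suc n)) = 1"
proof (induction n)
  case 0
  have "orb var_a var_b (Suc 0) = [:0, 1:]"
    by (simp add: cub_def var_b_def algebra_simps power2_eq_square power3_eq_cube)
  then show ?case by (simp del: orb.simps)
next
  case (Suc n)
  then show ?case
    by (metis degree_cub one_le_numeral one_le_power orb.simps(2) power_Suc)
qed

lemma lead_coeff_f_poly:
  assumes "n > 0"
  shows "lead_coeff (f_poly k n) = 1"
proof -
  obtain m where m: "k + n = Suc m" "k \<le> m" using assms by (cases n) auto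
  have "degree (orb var_a var_b k) < degree (orb var_a var_b (k + n))"
  proof (cases k)
    case 0
    then show ?thesis using degree_orb[of m] unfolding m by (simp add: var_a_def)
  next
    case (Suc i)
    then show ?thesis using degree_orb[of m] degree_orb[of i] m unfolding m
      by (simp del: orb.simps)
  qed
  then have lt: "degree (- orb var_a var_b k) < degree (orb var_a var_b (k + n))" by simp
  have "f_poly k n = - orb var_a var_b k + orb var_a var_b (k + n)"
    by (simp add: f_poly_eq)
  then have "lead_coeff (f_poly k n) = lead_coeff (orb var_a var_b (k + n))"
    using lead_coeff_add_le[OF lt] by (simp only:)
  then show ?thesis using degree_orb[of m] by (metis m(1))
qed

section \<open>Dividing out prime powers\<close>

lemma monic_poly_normalize:
  fixes p :: "int poly poly"
  assumes "lead_coeff p = 1"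
  shows "normalize p = p"
  using assms by (simp add: normalize_poly_eq_map_poly)

text \<open>The leading coefficient of p divides 1, and a normalized unit is 1. This matches the
  normalized primes of the factorization with the monic factors in
  \<open>lower_factors\<close>.\<close>

lemma prime_lead_coeff:
  fixes p L :: "int poly poly"
  assumes "normalize p = p" "p dvd L" "lead_coeff L = 1"
  shows "lead_coeff p = 1"
proof -
  have "lead_coeff p dvd 1" using assms(2,3) by (metis dvdE lead_coeff_mult dvd_triv_left)
  moreover have "normalize (lead_coeff p) = lead_coeff p" using assms(1)
    by (metis coeff_normalize div_unit_factor)
  ultimately show ?thesis by (metis is_unit_normalize)
qed

instance poly :: ("{factorial_ring_gcd, semiring_gcd_mult_normalize}") factorial_semiring_multiplicative ..

lemma div_prod_primes:
  fixes G L P :: "int poly poly"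
  assumes L: "lead_coeff L = 1" and "G \<noteq> 0" "P \<noteq> 0"
    and S: "\<And>g. g \<in> S \<Longrightarrow> irreducible g \<and> lead_coeff g = 1 \<and> g dvd P \<and> \<not> g dvd G"
    and LS: "\<And>g. irreducible g \<Longrightarrow> lead_coeff g = 1 \<Longrightarrow> g dvd L \<Longrightarrow> g \<in> S"
  shows "(G * L) div (\<Prod>g\<in>S. g ^ multiplicity g (G * L)) = G"
proof -
  have L0: "L \<noteq> 0" using L by auto
  have prime: "prime g" if "g \<in> S" for g
    using S[OF that] by (simp add: prime_def irreducible_imp_prime_elem monic_poly_normalize)
  have fin: "finite S"
    by (rule finite_subset[of _ "prime_factors P"])
      (use S prime \<open>P \<noteq> 0\<close> in \<open>auto simp: in_prime_factors_iff\<close>)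
  have "(\<Prod>g\<in>S. g ^ multiplicity g (G * L)) = (\<Prod>g\<in>S. g ^ multiplicity g L)"
  proof (rule prod.cong)
    fix g assume g: "g \<in> S"
    have "multiplicity g (G * L) = multiplicity g G + multiplicity g L"
      using prime[OF g] \<open>G \<noteq> 0\<close> L0 by (simp add: prime_elem_multiplicity_mult_distrib)
    then show "g ^ multiplicity g (G * L) = g ^ multiplicity g L"
      using S[OF g] by (simp add: not_dvd_imp_multiplicity_0)
  qed simp
  also have "\<dots> = (\<Prod>g\<in>prime_factors L. g ^ multiplicity g L)"
  proof (rule prod.mono_neutral_right[OF fin])
    show "prime_factors L \<subseteq> S"
    proof
      fix p assume "p \<in> prime_factors L"
      then have "prime p" "p dvd L" by auto
      then show "p \<in> S"
        using LS prime_lead_coeff[OF _ _ L] by (simp add: prime_def prime_elem_imp_irreducible)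
    qed
    show "\<forall>g\<in>S - prime_factors L. g ^ multiplicity g L = 1"
      using prime L0 by (auto simp: in_prime_factors_iff not_dvd_imp_multiplicity_0)
  qed
  also have "\<dots> = L" using prod_prime_factors[OF L0] by (simp only: monic_poly_normalize[OF L])
  finally show ?thesis using L0 by simp
qed

section \<open>Common factors of H with the lower polynomials\<close>

lemma ratio_transversal:
  assumes g: "prime_elem g" "lead_coeff g = 1" "degree g > 0"
    and dvd: "g dvd orb var_a var_b (Suc (Suc j)) - orb var_a var_b (Suc j)"
  shows "\<not> g dvd ratio var_a var_b j"
proof
  let ?x = "orb var_a var_b j" and ?y = "orb var_a var_b (Suc j)"
    and ?z = "orb var_a var_b (Suc (Suc j))" and ?H = "ratio var_a var_b j"
  assume H: "g dvd ?H"
  have "g dvd (?y - ?x) * quot var_a ?y ?x"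
    using dvd cub_diff[of var_a var_b ?y ?x] by simp
  then consider "g dvd ?y - ?x" | "g dvd quot var_a ?y ?x"
    using g(1) prime_elem_dvd_mult_iff by blast
  then show False
  proof cases
    case 1
    then have "g dvd ?H - (?y - ?x) * (?z + ?y + ?x)" using H by (simp del: orb.simps)
    then have "g dvd 1" by (simp add: ratio_def del: orb.simps)
    with g(1) show False by (simp add: prime_elem_not_unit)
  next
    case 2
    \<comment> \<open>Modulo g the point y is fixed, and 3 (y^2 - a^2) is the derivative of the
      cubic there; the identity exhibits its value -1 as an explicit combination of multiples of
      g.\<close>
    have "1 + 3 * (?y ^ 2 - var_a ^ 2) = ?H + quot var_a ?y ?x - (?z - ?y) * (?y - ?x)"
      unfolding ratio_def quot_def by (simp add: algebra_simps power2_eq_square del: orb.simps)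
    then have "g dvd 1 + 3 * (?y ^ 2 - var_a ^ 2)"
      using H 2 dvd by (metis dvd_add dvd_diff dvd_mult2)
    then obtain v where v: "1 + 3 * (?y ^ 2 - var_a ^ 2) = g * v" by (rule dvdE)
    have "g * v - 1 = 3 * (?y ^ 2 - var_a ^ 2)" unfolding v[symmetric] by simp
    moreover have "(3 :: int poly poly) = [:3:]" by (simp add: numeral_poly)
    ultimately have "[:3:] dvd g * v - 1" by (metis dvd_triv_left)
    then have "(3 :: int poly) dvd 1" by (rule monic_unit_mod_const[OF g(2,3)])
    then show False by (simp add: is_unit_poly_iff numeral_poly)
  qed
qed

text \<open>On the diagonal z = x the difference quotient becomes the derivative 3 (x - a)(x + a),
  so modulo g the periodic point x is critical. It remains to rule out -a.\<close>

lemma double_2_cycle: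
  assumes g: "prime_elem g" "lead_coeff g = 1" "degree g > 0"
    and dvd: "g dvd orb var_a var_b (Suc (Suc j)) - orb var_a var_b j"
    and quot: "g dvd quot var_a (orb var_a var_b (Suc (Suc j))) (orb var_a var_b j)"
  shows "g dvd orb var_a var_b j - var_a"
proof -
  let ?x = "orb var_a var_b j" and ?z = "orb var_a var_b (Suc (Suc j))"
  have "3 * ((?x - var_a) * (?x + var_a)) = quot var_a ?z ?x - (?z - ?x) * (?z + 2 * ?x)"
    unfolding quot_def by (simp add: algebra_simps power2_eq_square del: orb.simps)
  moreover have three: "(3 :: int poly poly) = [:[:3:]:]" by (simp add: numeral_poly)
  ultimately have "[:[:3:]:] * ((?x - var_a) * (?x + var_a)) =
      quot var_a ?z ?x - (?z - ?x) * (?z + 2 * ?x)"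
    by (simp only:)
  then have "g dvd [:[:3:]:] * ((?x - var_a) * (?x + var_a))"
    using dvd quot by (metis dvd_diff dvd_mult2)
  moreover have "\<not> g dvd [:[:3:]:]" using g(3) by (intro nonconst_not_dvd_const) auto
  moreover have "\<not> g dvd ?x + var_a"
  proof
    assume x: "g dvd ?x + var_a"
    \<comment> \<open>At a complex zero of g over a = 10, divisibility by g becomes an equation
      between numbers.\<close>
    obtain t where t: "specialize t g = 0" using specialize_root g(2,3) by blast
    have root: "specialize t p = 0" if "g dvd p" for p
      using that t by (auto simp: specialize_mult elim!: dvdE)
    have "orb 10 t j + 10 = 0"
      using root[OF x] by (simp add: specialize_add specialize_orb specialize_var)
    moreover have "orb 10 t (Suc (Suc j)) - orb 10 t j = 0"
      using root[OF dvd] by (simp only: specialize_diff specialize_orb)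
    ultimately show False using no_critical_2_cycle[of t j]
      by (simp add: add_eq_0_iff2 del: orb.simps)
  qed
  ultimately show ?thesis using g(1) prime_elem_dvd_mult_iff by blast
qed

lemma per2_not_dvd_diff:
  assumes "prime_elem g" "g dvd per2 a b"
  shows "\<not> g dvd b - a"
proof
  assume "g dvd b - a"
  then have "g dvd per2 a b - (b - a) * (b + 2 * a)" using assms(2) by simp
  then have "g dvd 1" by (simp add: per2_def)
  with assms(1) show False by (simp add: prime_elem_not_unit)
qed

lemma orb_diff_0_1: "orb a b (Suc 0) - orb a b 0 = b - a"
  by (simp add: cub_def algebra_simps power2_eq_square power3_eq_cube)

text \<open>Since x is congruent to a, the point a itself returns after two steps, and g divides (b
  - a) \<open>per2\<close>. A factor of b - a would make a fixed, which
  \<open>ratio_transversal\<close> forbids.\<close>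

lemma double_2_cycle_critical:
  assumes g: "prime_elem g" "lead_coeff g = 1" "degree g > 0"
    and dvd: "g dvd orb var_a var_b (Suc (Suc j)) - orb var_a var_b j"
    and H: "g dvd ratio var_a var_b j"
  shows "g dvd per2 var_a var_b" "even j"
proof -
  let ?x = "orb var_a var_b j" and ?y = "orb var_a var_b (Suc j)"
    and ?z = "orb var_a var_b (Suc (Suc j))"
  have "g dvd quot var_a ?z ?x" using H by (simp only: quot_period2 dvd_mult)
  from double_2_cycle[OF g dvd this] have x: "g dvd ?x - var_a" .
  have ab: "\<not> g dvd var_b - var_a"
  proof
    assume "g dvd var_b - var_a"
    then have "g dvd ?z - ?y"
      using orb_diff_dvd_mono[of 0 "Suc j" var_a var_b 1]
      by (metis orb_diff_0_1 dvd_trans One_nat_def add.commute plus_1_eq_Suc zero_le)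
    with ratio_transversal[OF g] H show False by blast
  qed
  have "g dvd cub var_a var_b (cub var_a var_b ?x) - cub var_a var_b (cub var_a var_b var_a)"
    by (intro dvd_cub_diff x)
  moreover have "cub var_a var_b var_a = var_b"
    by (simp add: cub_def algebra_simps power2_eq_square power3_eq_cube)
  \<comment> \<open>The combination telescopes to f^2(a) - a.\<close>
  ultimately have "g dvd (?z - ?x) + (?x - var_a) - (?z - orb var_a var_b 2)"
    using dvd x by (intro dvd_diff[OF dvd_add[OF dvd x]]) (simp add: numeral_2_eq_2)
  then have "g dvd (var_b - var_a) * per2 var_a var_b"
    by (simp add: orb_two[symmetric] del: orb.simps)
  then show per: "g dvd per2 var_a var_b" using ab g(1) prime_elem_dvd_mult_iff by blast
  show "even j"
  proof (rule ccontr)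
    \<comment> \<open>At odd indices the orbit is at b modulo \<open>per2\<close>, so g would divide
      b - a.\<close>
    assume "odd j"
    then obtain i where "j = Suc (2 * i)" by (auto elim: oddE)
    then have "g dvd ?x - var_b" using orb_parity[of var_a var_b i] per dvd_trans by blast
    then have "g dvd (?x - var_a) - (?x - var_b)" using x by (rule dvd_diff[rotated])
    with ab show False by simp
  qed
qed

text \<open>For even j any offending g must divide \<open>per2\<close>, and the residues from
  \<open>ratio_even\<close> decide whether it still divides G.\<close>

lemma primitive_ratio:
  obtains G where "ratio var_a var_b j = (if even j then per2 var_a var_b else 1) * G"
    and "\<And>g. prime_elem g \<Longrightarrow> lead_coeff g = 1 \<Longrightarrow> degree g > 0 \<Longrightarrow>
      g dvd orb var_a var_b (Suc (Suc j)) - orb var_a var_b (Suc j) \<or>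
      g dvd orb var_a var_b (Suc (Suc j)) - orb var_a var_b j \<Longrightarrow> \<not> g dvd G"
proof (cases "even j")
  case False
  show ?thesis
  proof (rule that[of "ratio var_a var_b j"])
    show "ratio var_a var_b j = (if even j then per2 var_a var_b else 1) * ratio var_a var_b j"
      using False by simp
  qed (use False ratio_transversal double_2_cycle_critical(2) in blast)
next
  case True
  then obtain i where i: "j = 2 * i" by (auto elim: evenE)
  obtain G where G: "ratio var_a var_b (2 * i) = per2 var_a var_b * G"
    and r: "per2 var_a var_b dvd G + 3 * (var_b - var_a) * var_a \<or>
      per2 var_a var_b dvd G + 6 * (var_b - var_a) * var_a"
    by (rule ratio_even)
  show ?thesis
  proof (rule that[of G])
    show "ratio var_a var_b j = (if even j then per2 var_a var_b else 1) * G"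
      using True G i by simp
    fix g
    assume g: "prime_elem g" "lead_coeff g = 1" "degree g > 0"
      and d: "g dvd orb var_a var_b (Suc (Suc j)) - orb var_a var_b (Suc j) \<or>
        g dvd orb var_a var_b (Suc (Suc j)) - orb var_a var_b j"
    show "\<not> g dvd G"
    proof
      assume gG: "g dvd G"
      then have H: "g dvd ratio var_a var_b j" using G i by simp
      with d ratio_transversal[OF g] double_2_cycle_critical(1)[OF g]
      have per: "g dvd per2 var_a var_b" by blast
      \<comment> \<open>The factor c a is a nonzero constant in b, too small in degree for g, and b
        - a is coprime to \<open>per2\<close>.\<close>
      have c: "\<not> g dvd of_int c * (var_b - var_a) * var_a" if "c \<noteq> 0" for c
      proof
        assume "g dvd of_int c * (var_b - var_a) * var_a"
        then have "g dvd (var_b - var_a) * [:[:0, c:]:]"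
          by (simp add: var_a_def of_int_poly algebra_simps)
        moreover have "\<not> g dvd [:[:0, c:]:]"
          using g(3) that by (intro nonconst_not_dvd_const) auto
        ultimately show False
          using per2_not_dvd_diff[OF g(1) per] g(1) prime_elem_dvd_mult_iff by blast
      qed
      from r show False
      proof
        assume "per2 var_a var_b dvd G + 3 * (var_b - var_a) * var_a"
        from dvd_trans[OF per this] have "g dvd 3 * (var_b - var_a) * var_a"
          by (simp only: dvd_add_right_iff[OF gG])
        with c[of 3] show False by simp
      next
        assume "per2 var_a var_b dvd G + 6 * (var_b - var_a) * var_a"
        from dvd_trans[OF per this] have "g dvd 6 * (var_b - var_a) * var_a"
          by (simp only: dvd_add_right_iff[OF gG])
        with c[of 6] show False by simp
      qed
    qed
  qed
qed

section \<open>Computation of h_{0,2} and h_{k,2}\<close>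

lemma f_poly_dvd_mono: "l \<le> k \<Longrightarrow> f_poly l n dvd f_poly k n"
  by (simp add: f_poly_eq orb_diff_dvd_mono)

lemma f_poly_0_2: "f_poly 0 2 = f_poly 0 1 * per2 var_a var_b"
  using orb_two[of var_a var_b] orb_diff_0_1[of var_a var_b]
  by (simp only: f_poly_eq add_0 One_nat_def orb.simps(1))

lemma dvd_2_cases: "m dvd 2 \<Longrightarrow> m = 1 \<or> m = (2::nat)"
  using two_is_prime_nat prime_nat_iff by blast

text \<open>The only pair below (0, 2) is (0, 1), so just the factor b - a is removed from
  f_{0,2}.\<close>

lemma h_poly_0_2: "h_poly 0 2 = per2 var_a var_b"
proof -
  have f: "f_poly 0 2 = per2 var_a var_b * f_poly 0 1"
    by (simp add: f_poly_0_2)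
  have nz: "f_poly 0 1 \<noteq> 0" "per2 var_a var_b \<noteq> 0"
    using lead_coeff_f_poly[of 1 0] lead_coeff_f_poly[of 2 0] f by auto
  have diff: "f_poly 0 1 = var_b - var_a"
    using orb_diff_0_1[of var_a var_b] by (simp add: f_poly_eq del: orb.simps(2))
  have lower: "g dvd f_poly 0 1" if "g \<in> lower_factors 0 2" for g
    using that dvd_2_cases by (auto simp: lower_factors_def)
  show ?thesis
    unfolding h_poly_def f
  proof (rule div_prod_primes[where P = "f_poly 0 1"])
    fix g assume g: "g \<in> lower_factors 0 2"
    then have "prime_elem g" by (simp add: lower_factors_def irreducible_imp_prime_elem)
    then have "\<not> g dvd per2 var_a var_b"
      using per2_not_dvd_diff lower[OF g] unfolding diff by blast
    with g lower[OF g] show "irreducible g \<and> lead_coeff g = 1 \<and> g dvd f_poly 0 1 \<and>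
        \<not> g dvd per2 var_a var_b"
      by (simp add: lower_factors_def)
  next
    fix g :: "int poly poly"
    assume "irreducible g" "lead_coeff g = 1" "g dvd f_poly 0 1"
    then show "g \<in> lower_factors 0 2"
      by (auto simp: lower_factors_def intro!: exI[of _ "1::nat"])
  qed (use nz lead_coeff_f_poly in auto)
qed

text \<open>The division-free form for k = j + 1. In f_{k,2} = G (f_{j,2} Q c) the bracket is monic
  with all its primes in \<open>lower_factors\<close>, while G has none of them; hence h_{k,2} =
  G.\<close>

lemma h_poly_Suc_2:
  "h_poly (Suc j) 2 * ((if even j then per2 var_a var_b else 1) * f_poly j 2 * f_poly (Suc j) 1) =
     f_poly (Suc j) 2 * f_poly j 1"
proof -
  define c where "c = (if even j then per2 var_a var_b else 1)"
  define Q where "Q = quot var_a (orb var_a var_b (Suc j)) (orb var_a var_b j)"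
  obtain G where G: "ratio var_a var_b j = c * G"
    and nd: "\<And>g. prime_elem g \<Longrightarrow> lead_coeff g = 1 \<Longrightarrow> degree g > 0 \<Longrightarrow>
      g dvd orb var_a var_b (Suc (Suc j)) - orb var_a var_b (Suc j) \<or>
      g dvd orb var_a var_b (Suc (Suc j)) - orb var_a var_b j \<Longrightarrow> \<not> g dvd G"
    unfolding c_def using primitive_ratio[of j] by blast
  have f1: "f_poly (Suc j) 1 = f_poly j 1 * Q"
    using orb_diff_Suc[of var_a var_b j 1] by (simp add: f_poly_eq Q_def del: orb.simps)
  have "f_poly (Suc j) 2 = f_poly j 2 * (Q * ratio var_a var_b j)"
    using orb_diff_Suc[of var_a var_b j 2] quot_period2[of var_a var_b j]
    by (simp add: f_poly_eq Q_def del: orb.simps)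
  then have f2: "f_poly (Suc j) 2 = G * (f_poly j 2 * Q * c)"
    by (simp add: G)
  have lead_c: "lead_coeff c = 1"
    using arg_cong[OF f_poly_0_2, of lead_coeff] lead_coeff_f_poly[of 1 0] lead_coeff_f_poly[of 2 0]
    by (simp add: c_def lead_coeff_mult)
  have lead_Q: "lead_coeff Q = 1"
    using arg_cong[OF f1, of lead_coeff] lead_coeff_f_poly[of 1 j] lead_coeff_f_poly[of 1 "Suc j"]
    by (simp add: lead_coeff_mult)
  have nz: "f_poly k n \<noteq> 0" if "n > 0" for k n
    using lead_coeff_f_poly[OF that, of k] by auto
  \<comment> \<open>By monotonicity in the first index every lower pair is dominated by (j + 1, 1)
    or (j, 2).\<close>
  have lower: "g dvd f_poly (Suc j) 1 \<or> g dvd f_poly j 2" if "g \<in> lower_factors (Suc j) 2" for g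
  proof -
    from that obtain l m where lm: "l \<le> Suc j" "m dvd 2" "(l, m) \<noteq> (Suc j, 2)" "g dvd f_poly l m"
      by (auto simp: lower_factors_def)
    from dvd_2_cases[OF lm(2)] show ?thesis
    proof
      assume "m = 1"
      with lm show ?thesis using f_poly_dvd_mono dvd_trans by blast
    next
      assume "m = 2"
      with lm have "l \<le> j" by auto
      with lm \<open>m = 2\<close> show ?thesis using f_poly_dvd_mono dvd_trans by blast
    qed
  qed
  have "h_poly (Suc j) 2 = G"
    unfolding h_poly_def f2
  proof (rule div_prod_primes[where P = "f_poly (Suc j) 1 * f_poly j 2"])
    show "lead_coeff (f_poly j 2 * Q * c) = 1"
      by (simp add: lead_coeff_mult lead_c lead_Q lead_coeff_f_poly)
    show "G \<noteq> 0" using nz[of 2 "Suc j"] f2 by auto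
    show "f_poly (Suc j) 1 * f_poly j 2 \<noteq> 0" using nz by simp
  next
    fix g assume g: "g \<in> lower_factors (Suc j) 2"
    then have g': "irreducible g" "lead_coeff g = 1" by (simp_all add: lower_factors_def)
    have "\<not> g dvd G"
      using nd[OF irreducible_imp_prime_elem[OF g'(1)] g'(2) irreducible_monic_degree_pos[OF g']]
        lower[OF g] by (simp add: f_poly_eq del: orb.simps)
    with g' lower[OF g]
    show "irreducible g \<and> lead_coeff g = 1 \<and> g dvd f_poly (Suc j) 1 * f_poly j 2 \<and> \<not> g dvd G"
      by auto
  next
    fix g :: "int poly poly"
    assume g: "irreducible g" "lead_coeff g = 1" and d: "g dvd f_poly j 2 * Q * c"
    have "g dvd f_poly j 2 \<or> g dvd Q \<or> g dvd c"
      using d irreducible_imp_prime_elem[OF g(1)] prime_elem_dvd_mult_iff by blast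
    \<comment> \<open>The pair (0, 2) is admissible because it differs from (j + 1, 2).\<close>
    moreover have "c dvd f_poly 0 2" by (simp add: c_def f_poly_0_2)
    moreover have "Q dvd f_poly (Suc j) 1" unfolding f1 by (rule dvd_triv_right)
    ultimately consider "g dvd f_poly j 2" | "g dvd f_poly (Suc j) 1" | "g dvd f_poly 0 2"
      using dvd_trans by blast
    then have "\<exists>l m. l \<le> Suc j \<and> 1 \<le> m \<and> m dvd 2 \<and> (l, m) \<noteq> (Suc j, 2) \<and> g dvd f_poly l m"
    proof cases
      case 1
      then show ?thesis by (intro exI[of _ j] exI[of _ 2]) auto
    next
      case 2
      then show ?thesis by (intro exI[of _ "Suc j"] exI[of _ 1]) auto
    next
      case 3
      then show ?thesis by (intro exI[of _ 0] exI[of _ 2]) auto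
    qed
    with g show "g \<in> lower_factors (Suc j) 2" by (simp add: lower_factors_def)
  qed
  then show ?thesis
    by (simp only: f1 f2 c_def[symmetric]) (simp only: ac_simps)
qed

theorem proposition1p3:
  shows "h_poly 0 2 = (var_b - var_a) * (var_b + 2 * var_a) + 1 \<and>
    (\<forall>k::nat. k > 0 \<longrightarrow>
      (odd k \<longrightarrow>
        to_fract (h_poly k 2) =
          to_fract (f_poly k 2 * f_poly (k - 1) 1) / to_fract (h_poly 0 2 * f_poly (k - 1) 2 * f_poly k 1)) \<and>
      (even k \<longrightarrow>
        to_fract (h_poly k 2) =
          to_fract (f_poly k 2 * f_poly (k - 1) 1) / to_fract (f_poly (k - 1) 2 * f_poly k 1)))"
proof -
  have eq_divide: "to_fract p = to_fract q / to_fract r" if "p * r = q" "r \<noteq> 0"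
    for p q r :: "int poly poly"
    using that by (simp add: eq_divide_eq flip: to_fract_mult)
  have nz: "f_poly k n \<noteq> 0" if "n > 0" for k n
    using lead_coeff_f_poly[OF that, of k] by auto
  have h0: "per2 var_a var_b \<noteq> 0" using nz[of 2 0] f_poly_0_2 by auto
  have "to_fract (h_poly (Suc j) 2) = to_fract (f_poly (Suc j) 2 * f_poly j 1) /
      to_fract ((if even j then per2 var_a var_b else 1) * f_poly j 2 * f_poly (Suc j) 1)" for j
    by (rule eq_divide[OF h_poly_Suc_2]) (simp add: nz h0)
  \<comment> \<open>With k = j + 1 the parity flips: even j corresponds to odd k.\<close>
  then have "to_fract (h_poly k 2) = to_fract (f_poly k 2 * f_poly (k - 1) 1) /
      to_fract ((if odd k then h_poly 0 2 else 1) * f_poly (k - 1) 2 * f_poly k 1)" if "k > 0" for k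
    using that by (cases k) (simp_all add: h_poly_0_2)
  moreover have "h_poly 0 2 = (var_b - var_a) * (var_b + 2 * var_a) + 1"
    by (simp add: h_poly_0_2 per2_def)
  ultimately show ?thesis by simp
qed

end
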